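(* Let $\Gamma$ be a finitely generated amenable group. Then we have $$\mathrm{RG}(\Gamma,(\Gamma_n))=0$$ for any Farber sequence $(\Gamma_n)$ in $\Gamma$.
   Context: **Rank gradient.** For a finitely generated group $H$ let $d(H)$ be its minimal number of generators. For a sequence $(\Gamma_n)$ of finite index subgroups of $\Gamma$ (not necessarily a chain), $\mathrm{RG}(\Gamma,(\Gamma_n))=\lim_{n\to\infty}\frac{d(\Gamma_n)-1}{|\Gamma:\Gamma_n|}$ when this limit exists. **Farber sequence.** Let $S$ be a finite symmetric generating set of $\Gamma$. For a finite index subgroup $H\le\Gamma$ the Schreier graph $\mathrm{Sch}(\Gamma,H,S)$ has the cosets of $H$ as vertices, with an edge labeled $s$ from each coset to its image under $s$, for each $s\in S$. A sequence $(\Gamma_n)$ of finite index subgroups of $\Gamma$ is Farber if the Schreier graphs $\mathrm{Sch}(\Gamma,\Gamma_n,S)$ form a sofic approximation of $\Gamma$, that is, for every $r$ the proportion of vertices $v$ of $\mathrm{Sch}(\Gamma,\Gamma_n,S)$ whose $r$-ball is isomorphic, as a rooted $S$-edge-labeled graph, to the $r$-ball around the identity in the Cayley graph $\mathrm{Cay}(\Gamma,S)$ tends to $1$ as $n\to\infty$. (This does not depend on $S$.)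
   Formalization: The group Γ is additionally assumed to be infinite; for a finite Γ every Farber sequence is eventually trivial, so the rank gradient is −1/|Γ| rather than 0 and the claim as written fails. *)

theory Defs
  imports Complex_Main "HOL-Algebra.Generated_Groups"
begin

definition finitely_generated :: "('a, 'b) monoid_scheme \<Rightarrow> bool" where
  "finitely_generated G \<longleftrightarrow> (\<exists>A. finite A \<and> A \<subseteq> carrier G \<and> generate G A = carrier G)"

(* The least cardinality of a finite generating set; only meaningful for
   finitely generated groups. The trivial group has value 0. *)
definition min_generators :: "('a, 'b) monoid_scheme \<Rightarrow> nat" where
  "min_generators G =
     (LEAST k. \<exists>A. finite A \<and> A \<subseteq> carrier G \<and> card A = k \<and> generate G A = carrier G)"

definition finite_index_subgroup :: "'a set \<Rightarrow> ('a, 'b) monoid_scheme \<Rightarrow> bool" where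
  "finite_index_subgroup H G \<longleftrightarrow> subgroup H G \<and> finite (rcosets\<^bsub>G\<^esub> H)"

definition subgroup_index :: "('a, 'b) monoid_scheme \<Rightarrow> 'a set \<Rightarrow> nat" where
  "subgroup_index G H = card (rcosets\<^bsub>G\<^esub> H)"

(* Existence of a left-invariant finitely additive probability measure defined on
   all subsets of the (discrete) group. *)
definition amenable :: "('a, 'b) monoid_scheme \<Rightarrow> bool" where
  "amenable G \<longleftrightarrow>
     (\<exists>\<mu> :: 'a set \<Rightarrow> real.
        \<mu> (carrier G) = 1 \<and>
        (\<forall>A. A \<subseteq> carrier G \<longrightarrow> 0 \<le> \<mu> A) \<and>
        (\<forall>A B. A \<subseteq> carrier G \<longrightarrow> B \<subseteq> carrier G \<longrightarrow> A \<inter> B = {} \<longrightarrow> \<mu> (A \<union> B) = \<mu> A + \<mu> B) \<and>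
        (\<forall>g \<in> carrier G. \<forall>A. A \<subseteq> carrier G \<longrightarrow> \<mu> (g <#\<^bsub>G\<^esub> A) = \<mu> A))"

definition symmetric_generating_set :: "('a, 'b) monoid_scheme \<Rightarrow> 'a set \<Rightarrow> bool" where
  "symmetric_generating_set G S \<longleftrightarrow>
     S \<subseteq> carrier G \<and> (\<forall>s \<in> S. inv\<^bsub>G\<^esub> s \<in> S) \<and> generate G S = carrier G"

(* Directed edge-labeled graphs: (u, s, v) is an edge labeled s from u to v. *)
record ('v, 'l) labeled_graph =
  verts :: "'v set"
  edges :: "('v \<times> 'l \<times> 'v) set"

(* Distances ignore the orientation of edges. The ball is the induced subgraph on
   the vertices at distance at most r from the root v. *)
definition adjacency :: "('v, 'l) labeled_graph \<Rightarrow> ('v \<times> 'v) set" where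
  "adjacency X = {(u, v). \<exists>s. (u, s, v) \<in> edges X \<or> (v, s, u) \<in> edges X}"

definition ball_verts :: "('v, 'l) labeled_graph \<Rightarrow> 'v \<Rightarrow> nat \<Rightarrow> 'v set" where
  "ball_verts X v r = {u \<in> verts X. \<exists>k\<le>r. (v, u) \<in> adjacency X ^^ k}"

definition graph_ball :: "('v, 'l) labeled_graph \<Rightarrow> 'v \<Rightarrow> nat \<Rightarrow> ('v, 'l) labeled_graph" where
  "graph_ball X v r =
     \<lparr>verts = ball_verts X v r,
      edges = {(x, s, y). (x, s, y) \<in> edges X \<and> x \<in> ball_verts X v r \<and> y \<in> ball_verts X v r}\<rparr>"

definition rooted_isomorphic ::
    "('v, 'l) labeled_graph \<Rightarrow> 'v \<Rightarrow> ('w, 'l) labeled_graph \<Rightarrow> 'w \<Rightarrow> bool" where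
  "rooted_isomorphic X x Y y \<longleftrightarrow>
     (\<exists>\<phi>. bij_betw \<phi> (verts X) (verts Y) \<and> \<phi> x = y \<and>
        (\<forall>u \<in> verts X. \<forall>v \<in> verts X. \<forall>s. (u, s, v) \<in> edges X \<longleftrightarrow> (\<phi> u, s, \<phi> v) \<in> edges Y))"

(* Convention: the generators act by right multiplication on right cosets. *)
definition schreier_graph ::
    "('a, 'b) monoid_scheme \<Rightarrow> 'a set \<Rightarrow> 'a set \<Rightarrow> ('a set, 'a) labeled_graph" where
  "schreier_graph G H S =
     \<lparr>verts = rcosets\<^bsub>G\<^esub> H,
      edges = {(c, s, c #>\<^bsub>G\<^esub> s) | c s. c \<in> rcosets\<^bsub>G\<^esub> H \<and> s \<in> S}\<rparr>"

definition cayley_graph :: "('a, 'b) monoid_scheme \<Rightarrow> 'a set \<Rightarrow> ('a, 'a) labeled_graph" where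
  "cayley_graph G S =
     \<lparr>verts = carrier G,
      edges = {(g, s, g \<otimes>\<^bsub>G\<^esub> s) | g s. g \<in> carrier G \<and> s \<in> S}\<rparr>"

definition sofic_approximation ::
    "('a, 'b) monoid_scheme \<Rightarrow> 'a set \<Rightarrow> (nat \<Rightarrow> ('v, 'a) labeled_graph) \<Rightarrow> bool" where
  "sofic_approximation G S X \<longleftrightarrow>
     (\<forall>r. (\<lambda>n. real (card {v \<in> verts (X n).
                  rooted_isomorphic (graph_ball (X n) v r) v
                    (graph_ball (cayley_graph G S) \<one>\<^bsub>G\<^esub> r) \<one>\<^bsub>G\<^esub>})
             / real (card (verts (X n)))) \<longlonglongrightarrow> 1)"

(* The property does not depend on the choice of the finite symmetric generating
   set S, so requiring it for some S is the same as requiring it for all of them. *)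
definition farber_sequence :: "('a, 'b) monoid_scheme \<Rightarrow> (nat \<Rightarrow> 'a set) \<Rightarrow> bool" where
  "farber_sequence G \<Gamma> \<longleftrightarrow>
     (\<forall>n. finite_index_subgroup (\<Gamma> n) G) \<and>
     (\<exists>S. finite S \<and> symmetric_generating_set G S \<and>
          sofic_approximation G S (\<lambda>n. schreier_graph G (\<Gamma> n) S))"

(* The limit defining the rank gradient exists and equals c. If G is finite and the
   subgroups are eventually trivial (as in every Farber sequence), then c = -1 / |G|. *)
definition has_rank_gradient ::
    "('a, 'b) monoid_scheme \<Rightarrow> (nat \<Rightarrow> 'a set) \<Rightarrow> real \<Rightarrow> bool" where
  "has_rank_gradient G \<Gamma> c \<longleftrightarrow>
     (\<lambda>n. (real (min_generators (G\<lparr>carrier := \<Gamma> n\<rparr>)) - 1) / real (subgroup_index G (\<Gamma> n)))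
       \<longlonglongrightarrow> c"

end

(* A generating set E of arrows of the groupoid of the action of G on the cosets of H, of which
   there are m, gives a generating set of H with |E| - m + 1 elements, by contracting a spanning
   tree. If F is a Folner set and f |-> x f is injective on F, then the arrows inside the tile x F
   that stay in F are generated by a star with at most |F| arrows, so a tiling of most cosets by
   (truncated) translates of F yields a generating set E with (1 + o(1)) m arrows. Such a tiling
   is found greedily: by averaging over all x, some tile x F meets the part that is not yet
   covered in a set with small boundary, and the Farber condition makes the non-injective tiles
   negligible. Folner sets come from the invariant measure: without them Hall's marriage theorem
   would give a paradoxical decomposition. *)
theory Submission
  imports Defs "HOL-Library.Disjoint_Sets"
begin

section \<open>Hall's marriage theorem for infinite families\<close>

definition hall_condition :: "'i set \<Rightarrow> ('i \<times> 'b) set \<Rightarrow> bool" where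
  "hall_condition I R \<longleftrightarrow> (\<forall>J\<subseteq>I. finite J \<longrightarrow> card J \<le> card (R `` J))"

text \<open>Zorn's lemma is applied to the sets \<open>D\<close> of removed pairs, ordered by
  inclusion. The union of a chain stays admissible because Hall's condition at a finite
  \<open>J\<close> only concerns the pairs over \<open>J\<close>, which are finite in
  number.\<close>

lemma minimal_hall_relation:
  assumes fin: "\<And>i. i \<in> I \<Longrightarrow> finite (R `` {i})" and hall: "hall_condition I R"
  obtains Q where "Q \<subseteq> R" "hall_condition I Q" "\<And>e. e \<in> Q \<Longrightarrow> \<not> hall_condition I (Q - {e})"
proof -
  define \<D> where "\<D> = {D. D \<subseteq> R \<and> hall_condition I (R - D)}"
  have "\<Union>\<C> \<in> \<D>" if ch: "subset.chain \<D> \<C>" for \<C>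
  proof (cases "\<C> = {}")
    case True
    then show ?thesis using hall by (simp add: \<D>_def)
  next
    case False
    have sub: "\<C> \<subseteq> \<D>" using ch by (simp add: subset.chain_def)
    have "card J \<le> card ((R - \<Union>\<C>) `` J)" if J: "J \<subseteq> I" "finite J" for J
    proof -
      \<comment> \<open>The removed pairs over \<open>J\<close>. This set is finite, so a single
        member \<open>D\<close> of the chain contains it, and over \<open>J\<close> removing the
        union is the same as removing \<open>D\<close>.\<close>
      define P where "P = \<Union>\<C> \<inter> (J \<times> UNIV)"
      have "finite (Sigma J (\<lambda>i. R `` {i}))"
        using J fin by (intro finite_SigmaI) auto
      moreover have "P \<subseteq> Sigma J (\<lambda>i. R `` {i})"
        using sub by (auto simp: P_def \<D>_def)
      ultimately have "finite P" by (rule rev_finite_subset)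
      then obtain D where D: "D \<in> \<C>" "P \<subseteq> D"
        using finite_subset_Union_chain[of P \<C> \<D>] False ch P_def by blast
      have "(R - \<Union>\<C>) `` J = (R - D) `` J"
        using D unfolding P_def by blast
      then show ?thesis
        using sub D J by (auto simp: \<D>_def hall_condition_def)
    qed
    then show ?thesis using sub by (auto simp: \<D>_def hall_condition_def)
  qed
  then obtain M where M: "M \<in> \<D>" "\<And>X. X \<in> \<D> \<Longrightarrow> M \<subseteq> X \<Longrightarrow> X = M"
    using subset_Zorn'[of \<D>] by blast
  show thesis
  proof (rule that[of "R - M"])
    show "R - M \<subseteq> R" "hall_condition I (R - M)" using M(1) by (auto simp: \<D>_def)
    show "\<not> hall_condition I (R - M - {e})" if e: "e \<in> R - M" for e
    proof
      assume "hall_condition I (R - M - {e})"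
      moreover have "R - M - {e} = R - insert e M" by blast
      ultimately have "insert e M \<in> \<D>" using M(1) e by (auto simp: \<D>_def)
      then show False using M(2)[of "insert e M"] e by blast
    qed
  qed
qed

text \<open>Rado's argument: in an inclusion-minimal relation satisfying Hall's condition, every
  element has exactly one partner.\<close>

theorem hall_marriage:
  assumes fin: "\<And>i. i \<in> I \<Longrightarrow> finite (R `` {i})" and hall: "hall_condition I R"
  obtains f where "inj_on f I" "\<And>i. i \<in> I \<Longrightarrow> (i, f i) \<in> R"
proof -
  obtain Q where Q: "Q \<subseteq> R" and hQ: "hall_condition I Q"
    and minQ: "\<And>e. e \<in> Q \<Longrightarrow> \<not> hall_condition I (Q - {e})"
    using minimal_hall_relation[OF fin hall] by blast
  have hallQ: "card J \<le> card (Q `` J)" if "J \<subseteq> I" "finite J" for J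
    using hQ that by (simp add: hall_condition_def)
  have finJ: "finite (Q `` J)" if "J \<subseteq> I" "finite J" for J
  proof -
    have "Q `` J \<subseteq> (\<Union>i\<in>J. R `` {i})" using Q by blast
    moreover have "finite (\<Union>i\<in>J. R `` {i})" using that fin by auto
    ultimately show ?thesis by (rule finite_subset)
  qed
  have critical: "\<exists>J. finite J \<and> J \<subseteq> I \<and> i \<in> J \<and> card ((Q - {(i, x)}) `` J) < card J"
    if ix: "(i, x) \<in> Q" for i x
  proof -
    obtain J where J: "J \<subseteq> I" "finite J" "card ((Q - {(i, x)}) `` J) < card J"
      using minQ[OF ix] by (auto simp: hall_condition_def not_le)
    have "i \<in> J"
    proof (rule ccontr)
      assume "i \<notin> J"
      then have "(Q - {(i, x)}) `` J = Q `` J" by auto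
      then show False using J hallQ[of J] by simp
    qed
    then show ?thesis using J by blast
  qed
  have unique: "x = y" if xy: "(i, x) \<in> Q" "(i, y) \<in> Q" for i x y
  proof (rule ccontr)
    assume ne: "x \<noteq> y"
    obtain J where J: "finite J" "J \<subseteq> I" "i \<in> J" "card ((Q - {(i, x)}) `` J) < card J"
      using critical[OF xy(1)] by blast
    obtain K where K: "finite K" "K \<subseteq> I" "i \<in> K" "card ((Q - {(i, y)}) `` K) < card K"
      using critical[OF xy(2)] by blast
    \<comment> \<open>Since \<open>x \<noteq> y\<close>, each of the two partners survives in the
      other relation, so \<open>A \<union> B\<close> contains all partners of
      \<open>J \<union> K\<close>, while \<open>A \<inter> B\<close> contains those of
      \<open>J \<inter> K - {i}\<close>. Adding both Hall inequalities gives |J| + |K| <= |A| + |B|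
      + 1, but criticality gives |A| + |B| <= |J| + |K| - 2.\<close>
    define A where "A = (Q - {(i, x)}) `` J"
    define B where "B = (Q - {(i, y)}) `` K"
    have finA: "finite A"
      unfolding A_def by (rule finite_subset[OF _ finJ[OF J(2,1)]]) blast
    have finB: "finite B"
      unfolding B_def by (rule finite_subset[OF _ finJ[OF K(2,1)]]) blast
    have "card (J \<union> K) \<le> card (Q `` (J \<union> K))" using J K by (intro hallQ) auto
    also have "\<dots> \<le> card (A \<union> B)"
      by (intro card_mono) (use finA finB ne J(3) K(3) in \<open>auto simp: A_def B_def\<close>)
    finally have U: "card (J \<union> K) \<le> card (A \<union> B)" .
    have "card (J \<inter> K - {i}) \<le> card (Q `` (J \<inter> K - {i}))" using J K by (intro hallQ) auto
    also have "\<dots> \<le> card (A \<inter> B)"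
      by (intro card_mono) (use finA in \<open>auto simp: A_def B_def\<close>)
    finally have "card (J \<inter> K) \<le> card (A \<inter> B) + 1"
      using J K by (simp add: card_Diff_singleton)
    then show False
      using U card_Un_Int[OF finA finB] card_Un_Int[OF J(1) K(1)] J(4) K(4)
      unfolding A_def[symmetric] B_def[symmetric] by linarith
  qed
  have "\<exists>x. (i, x) \<in> Q" if "i \<in> I" for i
  proof -
    have "1 \<le> card (Q `` {i})" using hallQ[of "{i}"] that by simp
    then have "Q `` {i} \<noteq> {}" by (metis card.empty not_one_le_zero)
    then show ?thesis by blast
  qed
  then obtain f where f: "\<And>i. i \<in> I \<Longrightarrow> (i, f i) \<in> Q" by metis
  have "inj_on f I"
  proof (rule inj_onI, rule ccontr)
    fix i j assume ij: "i \<in> I" "j \<in> I" "f i = f j" "i \<noteq> j"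
    have "Q `` {i, j} \<subseteq> {f i}"
    proof
      fix y assume "y \<in> Q `` {i, j}"
      then have "f i = y \<or> f j = y" using unique f ij(1,2) by blast
      then show "y \<in> {f i}" using ij(3) by simp
    qed
    then have "card (Q `` {i, j}) \<le> 1" using card_mono[of "{f i}"] by simp
    then show False using hallQ[of "{i, j}"] ij by simp
  qed
  then show thesis
    by (rule that) (use f Q in blast)
qed

section \<open>Folner sets in amenable groups\<close>

context group
begin

text \<open>Doubling is Hall's condition for matching two copies of the group into one, where
  \<open>g\<close> may only go to elements \<open>t \<otimes> g\<close>. Sorting the elements by the
  \<open>t\<close> used yields finitely many pieces of total measure 2 whose translates are
  disjoint.\<close>

lemma doubling_imp_not_amenable:
  assumes T: "finite T" "T \<subseteq> carrier G"
    and doubling: "\<And>F. finite F \<Longrightarrow> F \<subseteq> carrier G \<Longrightarrow> 2 * card F \<le> card (T <#> F)"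
  shows "\<not> amenable G"
proof
  assume "amenable G"
  then obtain \<mu> :: "'a set \<Rightarrow> real" where one: "\<mu> (carrier G) = 1"
    and nonneg: "\<And>A. A \<subseteq> carrier G \<Longrightarrow> 0 \<le> \<mu> A"
    and add: "\<And>A B. A \<subseteq> carrier G \<Longrightarrow> B \<subseteq> carrier G \<Longrightarrow> A \<inter> B = {} \<Longrightarrow> \<mu> (A \<union> B) = \<mu> A + \<mu> B"
    and inv: "\<And>g A. g \<in> carrier G \<Longrightarrow> A \<subseteq> carrier G \<Longrightarrow> \<mu> (g <# A) = \<mu> A"
    unfolding amenable_def by (elim exE conjE) (rule that, assumption, blast+)
  have empty: "\<mu> {} = 0" using add[of "{}" "{}"] by simp
  have \<mu>_UN: "\<mu> (\<Union>i\<in>I. B i) = (\<Sum>i\<in>I. \<mu> (B i))"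
    if "finite I" "\<And>i. i \<in> I \<Longrightarrow> B i \<subseteq> carrier G" "disjoint_family_on B I"
    for I and B :: "'a \<times> bool \<Rightarrow> 'a set"
    using that
  proof (induction I rule: finite_induct)
    case empty
    then show ?case using \<open>\<mu> {} = 0\<close> by simp
  next
    case (insert i I)
    have "\<mu> (B i \<union> (\<Union>j\<in>I. B j)) = \<mu> (B i) + \<mu> (\<Union>j\<in>I. B j)"
      using insert.prems insert.hyps
      by (intro add) (auto simp: disjoint_family_on_def)
    then show ?case
      using insert by (simp add: disjoint_family_on_mono[of I "insert i I"] subset_insertI)
  qed
  \<comment> \<open>The boolean distinguishes the two copies of the group.\<close>
  define R where "R = {((g, b::bool), t \<otimes> g) | g b t. g \<in> carrier G \<and> t \<in> T}"
  have img: "R `` J = T <#> fst ` J" if "J \<subseteq> carrier G \<times> UNIV" for J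
    using that by (force simp: R_def set_mult_def)
  have finTF: "finite (T <#> F)" if "finite F" for F
    using T that by (auto simp: set_mult_def)
  have "hall_condition (carrier G \<times> UNIV) R"
    unfolding hall_condition_def
  proof (intro allI impI)
    fix J :: "('a \<times> bool) set" assume J: "J \<subseteq> carrier G \<times> UNIV" "finite J"
    have "J \<subseteq> fst ` J \<times> UNIV" by force
    then have "card J \<le> card (fst ` J \<times> (UNIV :: bool set))"
      using J by (intro card_mono) auto
    also have "\<dots> = 2 * card (fst ` J)" by (simp add: card_cartesian_product)
    also have "\<dots> \<le> card (R `` J)"
    proof -
      have "fst ` J \<subseteq> carrier G" using J by auto
      then show ?thesis using doubling[of "fst ` J"] J img[of J] by simp
    qed
    finally show "card J \<le> card (R `` J)" .
  qed
  moreover have "finite (R `` {i})" if "i \<in> carrier G \<times> UNIV" for i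
    using that img[of "{i}"] finTF[of "{fst i}"] by auto
  ultimately obtain f where f: "inj_on f (carrier G \<times> UNIV)"
    and fR: "\<And>i. i \<in> carrier G \<times> UNIV \<Longrightarrow> (i, f i) \<in> R"
    using hall_marriage[of "carrier G \<times> (UNIV :: bool set)" R] by blast
  have fT: "\<exists>t\<in>T. f (g, b) = t \<otimes> g" if "g \<in> carrier G" for g b
    using fR[of "(g, b)"] that by (auto simp: R_def)
  \<comment> \<open>The piece of copy \<open>b\<close> on which the matching is left translation by
    \<open>t\<close>. For fixed \<open>b\<close> the pieces partition the group by right
    cancellation; injectivity of \<open>f\<close> on both copies makes all translated pieces
    disjoint.\<close>
  define A where "A = (\<lambda>(t, b). {g \<in> carrier G. f (g, b) = t \<otimes> g})"
  have Asub: "A i \<subseteq> carrier G" for i by (auto simp: A_def split: prod.splits)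
  have f_on_A: "f (g, snd i) = fst i \<otimes> g" if "g \<in> A i" for g i
    using that by (simp add: A_def case_prod_beta)
  then have shift: "fst i <# A i = (\<lambda>g. f (g, snd i)) ` A i" for i
    by (simp add: l_coset_def UNION_singleton_eq_range)
  have cover: "(\<Sum>t\<in>T. \<mu> (A (t, b))) = 1" for b
  proof -
    have "(\<Union>i\<in>T \<times> {b}. A i) = carrier G"
      using fT by (auto simp: A_def)
    moreover have "disjoint_family_on A (T \<times> {b})"
      using T(2) by (auto simp: disjoint_family_on_def A_def subset_iff)
    ultimately have "(\<Sum>i\<in>T \<times> {b}. \<mu> (A i)) = 1"
      using \<mu>_UN[of "T \<times> {b}" A] T Asub one by simp
    moreover have "(\<Sum>i\<in>T \<times> {b}. \<mu> (A i)) = (\<Sum>t\<in>T. \<mu> (A (t, b)))"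
      using sum.cartesian_product[of "\<lambda>t b. \<mu> (A (t, b))" "{b}" T] by (simp add: case_prod_beta)
    ultimately show ?thesis by simp
  qed
  have "disjoint_family_on (\<lambda>i. fst i <# A i) (T \<times> UNIV)"
    unfolding disjoint_family_on_def
  proof (intro ballI impI)
    fix i j assume ij: "i \<in> T \<times> (UNIV :: bool set)" "j \<in> T \<times> (UNIV :: bool set)" "i \<noteq> j"
    show "(fst i <# A i) \<inter> (fst j <# A j) = {}"
    proof (rule ccontr)
      assume "\<not> ?thesis"
      then obtain g h where gh: "g \<in> A i" "h \<in> A j" "f (g, snd i) = f (h, snd j)"
        unfolding shift by blast
      then have "(g, snd i) = (h, snd j)"
        using inj_onD[OF f, of "(g, snd i)" "(h, snd j)"] Asub by blast
      then have "snd i = snd j" "h = g" by auto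
      then have "fst i \<otimes> g = fst j \<otimes> g"
        using f_on_A[of g i] f_on_A[of h j] gh by simp
      moreover have "g \<in> carrier G" using gh(1) Asub by blast
      moreover have "fst i \<in> carrier G" "fst j \<in> carrier G" using ij T(2) by auto
      ultimately have "fst i = fst j" by simp
      then show False using ij(3) \<open>snd i = snd j\<close> by (simp add: prod_eq_iff)
    qed
  qed
  moreover have shift_sub: "fst i <# A i \<subseteq> carrier G" if "i \<in> T \<times> UNIV" for i
    using that T Asub by (intro l_coset_subset_G) auto
  ultimately have "\<mu> (\<Union>i\<in>T \<times> UNIV. fst i <# A i) = (\<Sum>i\<in>T \<times> UNIV. \<mu> (fst i <# A i))"
    using T by (intro \<mu>_UN) auto
  also have "\<dots> = (\<Sum>i\<in>T \<times> UNIV. \<mu> (A i))"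
    using T Asub by (intro sum.cong inv refl) auto
  also have "\<dots> = (\<Sum>t\<in>T. \<Sum>b\<in>UNIV. \<mu> (A (t, b)))"
    by (simp add: sum.cartesian_product)
  also have "\<dots> = 2"
    by (subst sum.swap) (simp add: cover)
  finally have two: "\<mu> (\<Union>i\<in>T \<times> UNIV. fst i <# A i) = 2" .
  have V: "(\<Union>i\<in>T \<times> UNIV. fst i <# A i) \<subseteq> carrier G" (is "?V \<subseteq> _")
    by (rule UN_least) (rule shift_sub)
  have "\<mu> (carrier G) = \<mu> (?V \<union> (carrier G - ?V))" using V by (simp add: Un_absorb1)
  also have "\<dots> = \<mu> ?V + \<mu> (carrier G - ?V)" using V by (intro add) auto
  finally show False using one two nonneg[of "carrier G - ?V"] by auto
qed

text \<open>Any expansion factor \<open>c > 1\<close> can be amplified to 2: by associativity of the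
  set product, the \<open>k\<close>-fold product of \<open>T\<close> expands every finite set by
  \<open>c ^ k\<close>.\<close>

lemma expanding_imp_not_amenable:
  fixes c :: real
  assumes T: "finite T" "T \<subseteq> carrier G" and c: "c > 1"
    and expanding: "\<And>F. finite F \<Longrightarrow> F \<subseteq> carrier G \<Longrightarrow> c * card F \<le> card (T <#> F)"
  shows "\<not> amenable G"
proof -
  have iter: "\<exists>K. finite K \<and> K \<subseteq> carrier G \<and>
      (\<forall>F. finite F \<and> F \<subseteq> carrier G \<longrightarrow> c ^ k * card F \<le> card (K <#> F))" for k
  proof (induction k)
    case 0
    have "{\<one>} <#> F = F" if "F \<subseteq> carrier G" for F
      using that by (force simp: set_mult_def)
    then show ?case by (intro exI[of _ "{\<one>}"]) auto
  next
    case (Suc k)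
    then obtain K where K: "finite K" "K \<subseteq> carrier G"
      and exp: "\<And>F. finite F \<Longrightarrow> F \<subseteq> carrier G \<Longrightarrow> c ^ k * card F \<le> card (K <#> F)" by blast
    have "c ^ Suc k * card F \<le> card ((T <#> K) <#> F)" if F: "finite F" "F \<subseteq> carrier G" for F
    proof -
      have KF: "finite (K <#> F)" "K <#> F \<subseteq> carrier G"
        using K F by (auto simp: set_mult_def)
      have "c ^ Suc k * card F \<le> c * card (K <#> F)"
        using exp[OF F] c by (simp add: mult.assoc)
      also have "\<dots> \<le> card (T <#> (K <#> F))" by (rule expanding[OF KF])
      finally show ?thesis using set_mult_assoc[OF T(2) K(2) F(2)] by simp
    qed
    moreover have "finite (T <#> K)" "T <#> K \<subseteq> carrier G"
      using T K by (auto simp: set_mult_def)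
    ultimately show ?case by blast
  qed
  obtain k where k: "2 < c ^ k" using real_arch_pow[OF c] by blast
  obtain K where K: "finite K" "K \<subseteq> carrier G"
    and exp: "\<And>F. finite F \<Longrightarrow> F \<subseteq> carrier G \<Longrightarrow> c ^ k * card F \<le> card (K <#> F)"
    using iter[of k] by (elim exE conjE) (rule that, assumption, assumption, simp)
  show ?thesis
  proof (rule doubling_imp_not_amenable[OF K])
    fix F assume F: "finite F" "F \<subseteq> carrier G"
    have "2 * real (card F) \<le> c ^ k * card F" using k by (intro mult_right_mono) auto
    then show "2 * card F \<le> card (K <#> F)" using exp[OF F] by linarith
  qed
qed

text \<open>Amenability forbids uniform expansion by \<open>T\<close>, which consists of the
  identity and the inverses of \<open>S\<close>; hence some \<open>E\<close> satisfies |TE| < (1 +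
  c)|E|. As \<open>T\<close> contains the identity, TE - E has fewer than c|E| elements, and it
  receives every point of \<open>E\<close> pushed out by some \<open>inv s\<close>.\<close>

theorem amenable_imp_Folner:
  fixes \<delta> :: real
  assumes am: "amenable G" and S: "finite S" "S \<subseteq> carrier G" and \<delta>: "\<delta> > 0"
  obtains F where "finite F" "F \<noteq> {}" "F \<subseteq> carrier G"
    "card {f \<in> F. \<exists>s\<in>S. f \<otimes> s \<notin> F} \<le> \<delta> * card F"
proof -
  \<comment> \<open>The boundary is a union over \<open>S\<close>, which costs a factor |S|; the
    added 1 keeps the denominator positive when \<open>S\<close> is empty.\<close>
  define c where "c = \<delta> / (card S + 1)"
  have c: "c > 0" using \<delta> by (simp add: c_def)
  define T where "T = insert \<one> (m_inv G ` S)"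
  have T: "finite T" "T \<subseteq> carrier G" using S by (auto simp: T_def)
  obtain E where E: "finite E" "E \<subseteq> carrier G" "card (T <#> E) < (1 + c) * card E"
    using expanding_imp_not_amenable[OF T, of "1 + c"] am c by (force simp: not_le)
  have ET: "E \<subseteq> T <#> E" using E(2) by (force simp: T_def set_mult_def)
  have finTE: "finite (T <#> E)" using T E by (auto simp: set_mult_def)
  have small: "card ((T <#> E) - E) \<le> c * card E"
  proof -
    have "card ((T <#> E) - E) = card (T <#> E) - card E"
      by (rule card_Diff_subset[OF E(1) ET])
    then show ?thesis
      using E(3) card_mono[OF finTE ET] by (simp add: algebra_simps of_nat_diff)
  qed
  have bound: "card {f \<in> E. inv s \<otimes> f \<notin> E} \<le> c * card E" if s: "s \<in> S" for s
  proof -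
    have "inj_on (\<lambda>f. inv s \<otimes> f) {f \<in> E. inv s \<otimes> f \<notin> E}"
      using s S E by (auto intro!: inj_onI simp: subset_iff)
    moreover have "(\<lambda>f. inv s \<otimes> f) ` {f \<in> E. inv s \<otimes> f \<notin> E} \<subseteq> (T <#> E) - E"
      using s by (auto simp: T_def set_mult_def)
    ultimately have "card {f \<in> E. inv s \<otimes> f \<notin> E} \<le> card ((T <#> E) - E)"
      using finTE by (intro card_inj_on_le) auto
    then show ?thesis using small by linarith
  qed
  \<comment> \<open>\<open>E\<close> is almost invariant under left multiplication, whereas the
    tiles need right multiplication. Inversion exchanges the two sides.\<close>
  define F where "F = m_inv G ` E"
  have inj: "inj_on (m_inv G) A" if "A \<subseteq> carrier G" for A
    using that inv_inj inj_on_subset by blast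
  have "{f \<in> F. \<exists>s\<in>S. f \<otimes> s \<notin> F} \<subseteq> m_inv G ` (\<Union>s\<in>S. {f \<in> E. inv s \<otimes> f \<notin> E})"
  proof
    fix x assume "x \<in> {f \<in> F. \<exists>s\<in>S. f \<otimes> s \<notin> F}"
    then obtain f s where fs: "f \<in> E" "x = inv f" "s \<in> S" "x \<otimes> s \<notin> F"
      by (auto simp: F_def)
    have "inv f \<otimes> s = inv (inv s \<otimes> f)"
      using fs S E by (simp add: inv_mult_group subset_iff)
    then have "inv s \<otimes> f \<notin> E" using fs by (auto simp: F_def)
    then show "x \<in> m_inv G ` (\<Union>s\<in>S. {f \<in> E. inv s \<otimes> f \<notin> E})" using fs by blast
  qed
  then have "card {f \<in> F. \<exists>s\<in>S. f \<otimes> s \<notin> F} \<le> card (\<Union>s\<in>S. {f \<in> E. inv s \<otimes> f \<notin> E})"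
    using S E by (intro surj_card_le) auto
  also have "\<dots> \<le> (\<Sum>s\<in>S. card {f \<in> E. inv s \<otimes> f \<notin> E})"
    by (rule card_UN_le[OF S(1)])
  finally have "real (card {f \<in> F. \<exists>s\<in>S. f \<otimes> s \<notin> F}) \<le> (\<Sum>s\<in>S. real (card {f \<in> E. inv s \<otimes> f \<notin> E}))"
    by (simp flip: of_nat_sum)
  also have "\<dots> \<le> card S * (c * card E)"
    using sum_mono[of S, OF bound] by simp
  also have "\<dots> \<le> \<delta> * card E"
  proof -
    have "card S * c \<le> \<delta>" using \<delta> by (simp add: c_def field_simps)
    then have "card S * c * card E \<le> \<delta> * card E" by (rule mult_right_mono) simp
    then show ?thesis by (simp add: mult.assoc)
  qed
  also have "card E = card F" using inj[OF E(2)] by (simp add: F_def card_image)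
  finally have "card {f \<in> F. \<exists>s\<in>S. f \<otimes> s \<notin> F} \<le> \<delta> * card F" .
  moreover have "E \<noteq> {}" using E(3) by auto
  ultimately show thesis
    using that[of F] E by (auto simp: F_def)
qed

end

section \<open>Rank of a subgroup and the Schreier groupoid\<close>

context group
begin

lemma inv_mult_cancel:
  assumes "x \<in> carrier G" "y \<in> carrier G"
  shows "inv x \<otimes> (x \<otimes> y) = y" "x \<otimes> (inv x \<otimes> y) = y"
  using assms by (simp_all add: m_assoc[symmetric])

lemma rcosets_subset_carrier:
  assumes "subgroup H G" "c \<in> rcosets H" shows "c \<subseteq> carrier G"
  using rcosets_subset_PowG assms by blast

lemma rcosets_r_coset_closed:
  assumes H: "subgroup H G" and "c \<in> rcosets H" "g \<in> carrier G"
  shows "c #> g \<in> rcosets H"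
proof -
  obtain w where "w \<in> carrier G" "c = H #> w" using assms by (auto simp: RCOSETS_def)
  then show ?thesis
    using assms(3) subgroup.subset[OF H] by (simp add: coset_mult_assoc rcosetsI)
qed

text \<open>A finite subtree of the Schreier graph rooted at \<open>H\<close>, with the transversal
  \<open>t\<close> read off along its branches. Connectedness is not stated: what is recorded is the
  number of arrows and that each of them has trivial Schreier generator with respect to
  \<open>t\<close>.\<close>

definition schreier_tree where
  "schreier_tree H E C t E\<^sub>0 \<longleftrightarrow> C \<subseteq> rcosets H \<and> H \<in> C \<and> E\<^sub>0 \<subseteq> E \<and> card E\<^sub>0 + 1 = card C \<and> t H = \<one> \<and>
    (\<forall>c\<in>C. t c \<in> carrier G \<and> H #> t c = c) \<and>
    (\<forall>c e. (c, e) \<in> E\<^sub>0 \<longrightarrow> c \<in> C \<and> c #> e \<in> C \<and> t (c #> e) = t c \<otimes> e)"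

text \<open>A pair \<open>(c, e)\<close> in \<open>E\<close> is an arrow from the coset \<open>c\<close> to \<open>c #> e\<close> in the transformation
  groupoid of the action on the cosets; the last hypothesis says that the arrows in \<open>E\<close>
  generate this groupoid. Contracting a spanning tree leaves the vertex group \<open>H\<close>.\<close>

context
  fixes H E
  assumes H: "subgroup H G" and fin: "finite (rcosets H)"
    and finE: "finite E" and E: "E \<subseteq> (rcosets H) \<times> carrier G"
    and generating: "\<And>P. P \<subseteq> carrier G \<Longrightarrow> \<one> \<in> P \<Longrightarrow>
      (\<And>w e. w \<in> carrier G \<Longrightarrow> (H #> w, e) \<in> E \<Longrightarrow> w \<in> P \<longleftrightarrow> w \<otimes> e \<in> P) \<Longrightarrow> P = carrier G"
begin

text \<open>The tree grows by one coset at a time. As long as \<open>C\<close> is not everything,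
  the elements whose coset lies in \<open>C\<close> form a proper subset containing
  \<open>\<one>\<close>, so by \<open>generating\<close> some arrow of \<open>E\<close> crosses the
  border of \<open>C\<close>.\<close>

lemma ex_schreier_tree:
  assumes "1 \<le> k" "k \<le> card (rcosets H)"
  shows "\<exists>C t E\<^sub>0. card C = k \<and> schreier_tree H E C t E\<^sub>0"
  using assms
proof (induction k rule: dec_induct)
  case base
  have "H \<in> rcosets H" using subgroup.subgroup_in_rcosets[OF H is_group] .
  then show ?case
    using subgroup.subset[OF H]
    by (intro exI[of _ "{H}"] exI[of _ "\<lambda>_. \<one>"] exI[of _ "{}"]) (auto simp: schreier_tree_def)
next
  case (step k)
  then obtain C t E\<^sub>0 where Ck: "card C = k" and tree: "schreier_tree H E C t E\<^sub>0" by auto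
  have C: "C \<subseteq> rcosets H" "H \<in> C" "E\<^sub>0 \<subseteq> E" "card E\<^sub>0 + 1 = k" "t H = \<one>"
    and t: "\<And>c. c \<in> C \<Longrightarrow> t c \<in> carrier G \<and> H #> t c = c"
    and E0: "\<And>c e. (c, e) \<in> E\<^sub>0 \<Longrightarrow> c \<in> C \<and> c #> e \<in> C \<and> t (c #> e) = t c \<otimes> e"
    using tree Ck unfolding schreier_tree_def by blast+
  have Hs: "H \<subseteq> carrier G" using subgroup.subset[OF H] .
  have finC: "finite C" using C(1) fin finite_subset by blast
  have finE0: "finite E\<^sub>0" using C(3) finE finite_subset by blast
  define P where "P = {w \<in> carrier G. H #> w \<in> C}"
  have "C \<noteq> rcosets H" using Ck step by auto
  then obtain w where "w \<in> carrier G" "H #> w \<notin> C" using C(1) by (auto simp: RCOSETS_def)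
  then have "P \<noteq> carrier G" by (auto simp: P_def)
  moreover have "P \<subseteq> carrier G" "\<one> \<in> P" using C(2) Hs by (auto simp: P_def)
  ultimately obtain w e where we: "w \<in> carrier G" "(H #> w, e) \<in> E" "(w \<in> P) \<noteq> (w \<otimes> e \<in> P)"
    using generating by blast
  have e: "e \<in> carrier G" using we E by blast
  have Hwe: "(H #> w) #> e = H #> (w \<otimes> e)" using we e Hs coset_mult_assoc by blast
  \<comment> \<open>The new coset \<open>d\<close> may be the source or the target of the crossing
    arrow; \<open>g\<close> is its representative, obtained by following the arrow in the
    appropriate direction.\<close>
  have extend: ?case if d: "d \<in> rcosets H" "d \<notin> C" "g \<in> carrier G" "H #> g = d"
    and arr: "(c, e) \<in> E" "c = d \<and> c #> e \<in> C \<and> t (c #> e) = g \<otimes> e \<or> c #> e = d \<and> c \<in> C \<and> g = t c \<otimes> e"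
    for d g c e
  proof (intro exI[of _ "insert d C"] exI[of _ "t(d := g)"] exI[of _ "insert (c, e) E\<^sub>0"] conjI)
    have "(c, e) \<notin> E\<^sub>0" using arr d(2) E0 by blast
    then have "card (insert (c, e) E\<^sub>0) + 1 = Suc k" using finE0 C(4) by simp
    moreover show "card (insert d C) = Suc k" using finC d Ck by simp
    ultimately have card: "card (insert (c, e) E\<^sub>0) + 1 = card (insert d C)" by simp
    have "(t(d := g)) H = \<one>" "H \<in> insert d C" "insert d C \<subseteq> rcosets H" "insert (c, e) E\<^sub>0 \<subseteq> E"
      using C d arr by auto
    moreover have "\<forall>c\<in>insert d C. (t(d := g)) c \<in> carrier G \<and> H #> (t(d := g)) c = c"
      using t d by auto
    moreover have "c' \<in> insert d C \<and> c' #> e' \<in> insert d C \<and>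
        (t(d := g)) (c' #> e') = (t(d := g)) c' \<otimes> e'" if "(c', e') \<in> insert (c, e) E\<^sub>0" for c' e'
    proof (cases "(c', e') \<in> E\<^sub>0")
      case True
      then show ?thesis using E0[OF True] d(2) by auto
    next
      case False
      then show ?thesis using that arr d(2) by auto
    qed
    ultimately show "schreier_tree H E (insert d C) (t(d := g)) (insert (c, e) E\<^sub>0)"
      using card unfolding schreier_tree_def by blast
  qed
  show ?case
  proof (cases "w \<in> P")
    case True
    then have "H #> w \<in> C" "H #> (w \<otimes> e) \<notin> C" using we e by (auto simp: P_def)
    moreover have "H #> (t (H #> w) \<otimes> e) = H #> (w \<otimes> e)"
      using t[OF calculation(1)] e Hs Hwe by (metis coset_mult_assoc)
    ultimately show ?thesis
      using t[of "H #> w"] we e Hs Hwe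
      by (intro extend[of "H #> (w \<otimes> e)" "t (H #> w) \<otimes> e" "H #> w" e]) (auto intro: rcosetsI)
  next
    case False
    then have in_C: "H #> (w \<otimes> e) \<in> C" and out: "H #> w \<notin> C" using we e by (auto simp: P_def)
    \<comment> \<open>The arrow enters \<open>C\<close>, so it is followed backwards from the known
      representative of its target.\<close>
    define g where "g = t (H #> (w \<otimes> e)) \<otimes> inv e"
    have tc: "t (H #> (w \<otimes> e)) \<in> carrier G" "H #> t (H #> (w \<otimes> e)) = H #> (w \<otimes> e)"
      using t[OF in_C] by auto
    have "H #> g = (H #> (w \<otimes> e)) #> inv e"
      using tc e Hs by (simp add: g_def coset_mult_assoc[symmetric])
    also have "\<dots> = H #> w" using we e Hs by (simp add: coset_mult_assoc m_assoc)
    finally have "H #> g = H #> w" .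
    moreover have "g \<otimes> e = t (H #> (w \<otimes> e))" using tc e by (simp add: g_def m_assoc)
    ultimately show ?thesis
      using in_C out tc we e Hs Hwe
      by (intro extend[of "H #> w" g "H #> w" e]) (auto simp: g_def intro: rcosetsI)
  qed
qed

theorem subgroup_rank_le_arrows:
  "\<exists>A\<subseteq>H. finite A \<and> generate G A = H \<and> card A + card (rcosets H) \<le> card E + 1"
proof -
  have Hs: "H \<subseteq> carrier G" using subgroup.subset[OF H] .
  have "rcosets H \<noteq> {}" using subgroup.subgroup_in_rcosets[OF H is_group] by blast
  then have "1 \<le> card (rcosets H)" using fin by (simp add: Suc_le_eq card_gt_0_iff)
  from ex_schreier_tree[OF this order_refl]
  obtain C t E\<^sub>0 where Ck: "card C = card (rcosets H)" and T: "schreier_tree H E C t E\<^sub>0" by blast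
  have C: "C \<subseteq> rcosets H"
    and E0: "E\<^sub>0 \<subseteq> E" "card E\<^sub>0 + 1 = card C" "t H = \<one>"
    and t: "\<And>c. c \<in> C \<Longrightarrow> t c \<in> carrier G \<and> H #> t c = c"
    and tree: "\<And>c e. (c, e) \<in> E\<^sub>0 \<Longrightarrow> t (c #> e) = t c \<otimes> e"
    using T unfolding schreier_tree_def by blast+
  have CX: "C = rcosets H" using card_subset_eq[OF fin C Ck] .
  define \<alpha> where "\<alpha> = (\<lambda>(c, e). t c \<otimes> e \<otimes> inv t (c #> e))"
  define A where "A = \<alpha> ` (E - E\<^sub>0)"
  have tw: "t c \<in> carrier G" "H #> t c = c" if "c \<in> rcosets H" for c
    using t[of c] that CX by auto
  have in_H: "a \<otimes> inv b \<in> H" if "a \<in> carrier G" "b \<in> carrier G" "H #> a = H #> b" for a b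
  proof (rule coset_join1[OF _ _ H])
    show "H #> (a \<otimes> inv b) = H"
      using that Hs by (metis coset_mult_inv2 coset_mult_assoc coset_mult_one inv_closed r_inv)
  qed (use that in auto)
  have AH: "A \<subseteq> H"
  proof
    fix a assume "a \<in> A"
    then obtain c e where ce: "(c, e) \<in> E" "a = t c \<otimes> e \<otimes> inv t (c #> e)"
      by (auto simp: A_def \<alpha>_def)
    have c: "c \<in> rcosets H" "e \<in> carrier G" using ce E by auto
    have d: "c #> e \<in> rcosets H" using rcosets_r_coset_closed[OF H] c by blast
    have "H #> (t c \<otimes> e) = c #> e" using tw[OF c(1)] c Hs by (metis coset_mult_assoc)
    then show "a \<in> H"
      unfolding ce(2) using tw c d by (intro in_H) auto
  qed
  define K where "K = generate G A"
  have KG: "subgroup K G" unfolding K_def using AH Hs by (intro generate_is_subgroup) auto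
  have KH: "K \<subseteq> H" unfolding K_def by (rule generate_subgroup_incl[OF AH H])
  have \<alpha>K: "t c \<otimes> e \<otimes> inv t (c #> e) \<in> K" if "(c, e) \<in> E" for c e
  proof (cases "(c, e) \<in> E\<^sub>0")
    case True
    have "c \<in> rcosets H" "e \<in> carrier G" using that E by auto
    then have "t c \<otimes> e \<otimes> inv t (c #> e) = \<one>" using tree[OF True] tw by (simp del: inv_mult_group)
    then show ?thesis using KG by (simp add: subgroup.one_closed)
  next
    case False
    then have "\<alpha> (c, e) \<in> A" using that by (auto simp: A_def)
    then show ?thesis unfolding K_def \<alpha>_def by (auto intro: generate.incl)
  qed
  \<comment> \<open>The elements whose \<open>H\<close>-part relative to the transversal lies in
    \<open>K\<close>. Moving along an arrow multiplies this part on the right by a Schreier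
    generator, so \<open>generating\<close> applies. On \<open>H\<close> the representative is
    \<open>\<one>\<close>, and therefore \<open>H \<subseteq> K\<close>.\<close>
  define P where "P = {w \<in> carrier G. w \<otimes> inv t (H #> w) \<in> K}"
  have "P = carrier G"
  proof (rule generating)
    show "P \<subseteq> carrier G" by (auto simp: P_def)
    show "\<one> \<in> P" using E0(3) Hs KG by (auto simp: P_def subgroup.one_closed)
    fix w e assume we: "w \<in> carrier G" "(H #> w, e) \<in> E"
    have e: "e \<in> carrier G" and c: "H #> w \<in> rcosets H" using we E by auto
    have d: "(H #> w) #> e = H #> (w \<otimes> e)" using coset_mult_assoc we e Hs by blast
    have d': "H #> (w \<otimes> e) \<in> rcosets H" using we e Hs by (intro rcosetsI) auto
    define a where "a = t (H #> w) \<otimes> e \<otimes> inv t (H #> (w \<otimes> e))"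
    define b where "b = w \<otimes> inv t (H #> w)"
    have aK: "a \<in> K" using \<alpha>K[OF we(2)] d by (simp add: a_def)
    have aG: "a \<in> carrier G" using aK KG subgroup.subset by blast
    have bG: "b \<in> carrier G" using we tw[OF c] by (simp add: b_def)
    have "w \<otimes> e \<otimes> inv t (H #> (w \<otimes> e)) = b \<otimes> a"
      using we e tw[OF c] tw[OF d']
      by (simp add: a_def b_def m_assoc inv_mult_cancel)
    moreover have "b \<otimes> a \<in> K \<longleftrightarrow> b \<in> K"
    proof
      assume "b \<otimes> a \<in> K"
      then have "b \<otimes> a \<otimes> inv a \<in> K" using aK KG by (simp add: subgroup.m_closed subgroup.m_inv_closed)
      then show "b \<in> K" using aG bG by (simp add: m_assoc)
    qed (use aK KG in \<open>simp add: subgroup.m_closed\<close>)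
    ultimately show "w \<in> P \<longleftrightarrow> w \<otimes> e \<in> P"
      using we e by (simp add: P_def b_def)
  qed
  have "H \<subseteq> K"
  proof
    fix h assume h: "h \<in> H"
    then have "h \<in> P" using Hs \<open>P = carrier G\<close> by auto
    moreover have "H #> h = H" using h H Hs by (intro coset_join2) auto
    ultimately show "h \<in> K" using E0(3) h Hs by (auto simp: P_def)
  qed
  then have "generate G A = H" using KH K_def by blast
  moreover have "card A \<le> card (E - E\<^sub>0)" unfolding A_def by (rule card_image_le) (use finE in simp)
  moreover have "card (E - E\<^sub>0) = card E - card E\<^sub>0" "card E\<^sub>0 \<le> card E"
    using E0(1) finE finite_subset by (auto intro: card_Diff_subset card_mono)
  moreover have "finite A" using finE by (simp add: A_def)
  ultimately show ?thesis using AH E0(2) Ck by (intro exI[of _ A]) auto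
qed

end
end

section \<open>Tiling Schreier graphs\<close>

context group
begin

lemma card_coset_translate:
  assumes H: "subgroup H G" and fin: "finite (rcosets H)" and Y: "Y \<subseteq> rcosets H" and g: "g \<in> carrier G"
  shows "card {x \<in> rcosets H. x #> g \<in> Y} = card Y"
proof (rule bij_betw_same_card)
  have cancel: "(x #> g) #> inv g = x" "(x #> inv g) #> g = x" if "x \<in> rcosets H" for x
    using rcosets_subset_carrier[OF H that] g by (simp_all add: coset_mult_assoc)
  show "bij_betw (\<lambda>x. x #> g) {x \<in> rcosets H. x #> g \<in> Y} Y"
    by (rule bij_betw_byWitness[where f' = "\<lambda>y. y #> inv g"])
      (use cancel Y g rcosets_r_coset_closed[OF H] in auto)
qed

text \<open>Double counting of pairs: for fixed \<open>f\<close>, right translation by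
  \<open>f\<close> permutes the cosets, so exactly |Y| of them are sent into
  \<open>Y\<close>.\<close>

lemma sum_card_tiles:
  assumes H: "subgroup H G" and fin: "finite (rcosets H)" and Y: "Y \<subseteq> rcosets H"
    and A: "finite A" "A \<subseteq> carrier G"
  shows "(\<Sum>x\<in>rcosets H. card {f \<in> A. x #> f \<in> Y}) = card A * card Y"
  using sum_multicount[OF fin A(1), of "\<lambda>x f. x #> f \<in> Y" "card Y"]
    card_coset_translate[OF H fin Y] A by (auto simp: mult.commute)

text \<open>Averaging over all \<open>x\<close>: the tile \<open>x F\<close> meets a given set \<open>Y\<close> in \<open>|F| |Y| / |X|\<close> points on
  average, and its boundary in \<open>|D| |Y| / |X|\<close> points.\<close>

lemma ex_tile_small_boundary:
  fixes \<delta> :: real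
  assumes H: "subgroup H G" and fin: "finite (rcosets H)" and Y: "Y \<subseteq> rcosets H"
    and F: "finite F" "F \<subseteq> carrier G" "F \<noteq> {}" and D: "D \<subseteq> F" "card D \<le> \<delta> * card F"
    and Z: "Z \<subseteq> rcosets H" and large: "2 * card (rcosets H - Z) < card Y"
  obtains x where "x \<in> Z" "{f \<in> F. x #> f \<in> Y} \<noteq> {}"
    "card {f \<in> D. x #> f \<in> Y} \<le> 2 * \<delta> * card {f \<in> F. x #> f \<in> Y}"
proof -
  let ?X = "rcosets H"
  define NF where "NF x = card {f \<in> F. x #> f \<in> Y}" for x
  define ND where "ND x = card {f \<in> D. x #> f \<in> Y}" for x
  have finD: "finite D" using D F finite_subset by blast
  have "\<exists>x\<in>Z. NF x \<noteq> 0 \<and> ND x \<le> 2 * \<delta> * NF x"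
  proof (rule ccontr)
    assume contra: "\<not> ?thesis"
    have zero: "ND x = 0" if "NF x = 0" for x
    proof -
      have "{f \<in> F. x #> f \<in> Y} = {}" using that F by (simp add: NF_def)
      then have "{f \<in> D. x #> f \<in> Y} = {}" using D by blast
      then show ?thesis by (metis ND_def card.empty)
    qed
    have le: "2 * \<delta> * NF x \<le> ND x" if "x \<in> Z" for x
      using contra that zero[of x] by (cases "NF x = 0") (auto simp: not_le intro: less_imp_le)
    have sumF: "sum NF ?X = card F * card Y"
      unfolding NF_def by (rule sum_card_tiles[OF H fin Y F(1,2)])
    have sumD: "sum ND ?X = card D * card Y"
      unfolding ND_def by (rule sum_card_tiles[OF H fin Y finD]) (use D F in blast)
    have split: "sum NF ?X = sum NF Z + sum NF (?X - Z)"
      using sum.subset_diff[OF Z fin, of NF] by simp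
    \<comment> \<open>A coset outside \<open>Z\<close> contributes at most |F|, so by
      \<open>large\<close> these cosets carry less than half of the total |F||Y|. The other half, on
      \<open>Z\<close>, accounts for the factor 2 in the bound \<open>2 * \<delta>\<close>.\<close>
    have "sum NF (?X - Z) \<le> card (?X - Z) * card F"
      using sum_bounded_above[of "?X - Z" NF "card F"] F by (auto simp: NF_def intro: card_mono)
    then have "2 * sum NF (?X - Z) \<le> 2 * card (?X - Z) * card F" by simp
    moreover have "2 * card (?X - Z) * card F < card Y * card F"
      using large F by (simp add: card_gt_0_iff)
    ultimately have "2 * sum NF (?X - Z) < card F * card Y" by (simp only: mult.commute)
    then have half: "card F * card Y < 2 * sum NF Z"
      using split sumF by linarith
    have "card F > 0" using F by (simp add: card_gt_0_iff)
    have "0 \<le> \<delta> * card F" using D(2) by (meson of_nat_0_le_iff order_trans)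
    then have \<delta>0: "0 \<le> \<delta>" using \<open>card F > 0\<close> by (simp add: zero_le_mult_iff)
    have "2 * \<delta> * sum NF Z \<le> real (sum ND Z)"
      using sum_mono[of Z, OF le] by (simp add: sum_distrib_left)
    also have "\<dots> \<le> real (sum ND ?X)"
      using sum_mono2[OF fin Z, of ND] by (simp del: of_nat_sum)
    also have "\<dots> = card D * real (card Y)" using sumD by simp
    also have "\<dots> \<le> \<delta> * card F * card Y" using D(2) by (rule mult_right_mono) simp
    finally have main: "\<delta> * (2 * real (sum NF Z)) \<le> \<delta> * (real (card F * card Y))"
      by (simp add: algebra_simps)
    \<comment> \<open>Cancelling \<open>\<delta>\<close> in \<open>main\<close> requires this. If
      \<open>\<delta> = 0\<close>, then \<open>D\<close> is empty and every \<open>x\<close> in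
      \<open>Z\<close> whose tile meets \<open>Y\<close> contradicts the assumption.\<close>
    have "\<delta> \<noteq> 0"
    proof
      assume "\<delta> = 0"
      then have "D = {}" using D finD by simp
      moreover have "sum NF Z \<noteq> 0" using half by (metis mult_0_right not_less0)
      then obtain x where "x \<in> Z" "NF x \<noteq> 0" by (meson sum.neutral)
      ultimately show False using contra \<open>\<delta> = 0\<close> by (auto simp: ND_def)
    qed
    then have "2 * real (sum NF Z) \<le> real (card F * card Y)" using main \<delta>0 by simp
    then show False using half by linarith
  qed
  then obtain x where x: "x \<in> Z" "NF x \<noteq> 0" "ND x \<le> 2 * \<delta> * NF x" by blast
  have "{f \<in> F. x #> f \<in> Y} \<noteq> {}" using x(2) by (metis NF_def card.empty)
  then show thesis using that[OF x(1)] x(3) unfolding NF_def ND_def by blast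
qed

text \<open>Group elements \<open>w\<close> are the groupoid arrows from \<open>H\<close> to
  \<open>H #> w\<close>, so \<open>P\<close> is a set of such arrows closed under composition with
  the arrows of \<open>E\<close> and their inverses. Quantifying over all such \<open>P\<close>
  expresses what \<open>E\<close> generates without constructing the generated subgroupoid.\<close>

definition arrow_invariant where
  "arrow_invariant H E P \<longleftrightarrow> (\<forall>w\<in>carrier G. \<forall>e. (H #> w, e) \<in> E \<longrightarrow> (w \<in> P \<longleftrightarrow> w \<otimes> e \<in> P))"

text \<open>The set \<open>E\<close> consists of a star in each tile, of all arrows issuing from the boundaries of the
  tiles and of all arrows issuing from the part that is not tiled. Tiles are cut out of \<open>Y\<close> one
  after the other. An arrow entering a tile later is the inverse of an arrow leaving it.\<close>

lemma ex_cheap_arrows: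
  fixes \<delta> :: real
  assumes H: "subgroup H G" and fin: "finite (rcosets H)"
    and S: "finite S" "S \<subseteq> carrier G" "\<forall>s\<in>S. inv s \<in> S"
    and F: "finite F" "F \<subseteq> carrier G" "F \<noteq> {}" "card {f \<in> F. \<exists>s\<in>S. f \<otimes> s \<notin> F} \<le> \<delta> * card F"
    and Z: "Z \<subseteq> rcosets H" "\<forall>x\<in>Z. inj_on (\<lambda>f. x #> f) F"
    and Y: "Y \<subseteq> rcosets H"
  shows "\<exists>E. finite E \<and> E \<subseteq> (rcosets H) \<times> carrier G \<and>
    card E \<le> card Y + card S * (2 * \<delta> * card Y + 2 * card (rcosets H - Z)) \<and>
    (\<forall>P. arrow_invariant H E P \<longrightarrow> (\<forall>w\<in>carrier G. \<forall>s\<in>S.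
      H #> w \<in> Y \<longrightarrow> H #> (w \<otimes> s) \<in> Y \<longrightarrow> (w \<in> P \<longleftrightarrow> w \<otimes> s \<in> P)))"
  using Y
proof (induction "card Y" arbitrary: Y rule: less_induct)
  case less
  note Y = less.prems
  have finY: "finite Y" using Y fin finite_subset by blast
  have Hs: "H \<subseteq> carrier G" using subgroup.subset[OF H] .
  define D where "D = {f \<in> F. \<exists>s\<in>S. f \<otimes> s \<notin> F}"
  have D: "D \<subseteq> F" "card D \<le> \<delta> * card F" using F by (auto simp: D_def)
  have "card F > 0" using F by (simp add: card_gt_0_iff)
  moreover have "0 \<le> \<delta> * card F" using D(2) by (meson of_nat_0_le_iff order_trans)
  ultimately have \<delta>0: "0 \<le> \<delta>" by (simp add: zero_le_mult_iff)
  show ?case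
  proof (cases "2 * card (rcosets H - Z) < card Y")
    case False
    \<comment> \<open>The recursion stops here: \<open>Y\<close> has at most twice as many cosets as
      the complement of \<open>Z\<close>, so all generator arrows issuing from \<open>Y\<close> are
      affordable.\<close>
    have "real (card (Y \<times> S)) = card S * real (card Y)" by (simp add: card_cartesian_product)
    also have "\<dots> \<le> card S * (2 * real (card (rcosets H - Z)))"
      using False by (intro mult_left_mono) linarith+
    also have "\<dots> \<le> card Y + card S * (2 * \<delta> * card Y + 2 * card (rcosets H - Z))"
      using \<delta>0 by (simp add: algebra_simps)
    finally have "card (Y \<times> S) \<le> card Y + card S * (2 * \<delta> * card Y + 2 * card (rcosets H - Z))" .
    then show ?thesis
      using finY S(1,2) Y by (intro exI[of _ "Y \<times> S"]) (auto simp: arrow_invariant_def)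
  next
    case True
    obtain x where x: "x \<in> Z" and ne: "{f \<in> F. x #> f \<in> Y} \<noteq> {}"
      and small: "card {f \<in> D. x #> f \<in> Y} \<le> 2 * \<delta> * card {f \<in> F. x #> f \<in> Y}"
      using ex_tile_small_boundary[OF H fin Y F(1-3) D Z(1) True] by blast
    have xX: "x \<in> rcosets H" using x Z by blast
    have xG: "x \<subseteq> carrier G" by (rule rcosets_subset_carrier[OF H xX])
    \<comment> \<open>The part of the tile still lying in \<open>Y\<close>. Since \<open>x\<close>
      is in \<open>Z\<close>, its points are distinct, and the star at an arbitrary centre
      \<open>x #> f\<^sub>0\<close> costs at most |T| arrows, which is what removing
      \<open>T\<close> from \<open>Y\<close> pays for.\<close>
    define F' where "F' = {f \<in> F. x #> f \<in> Y}"
    define D' where "D' = {f \<in> D. x #> f \<in> Y}"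
    define T where "T = (\<lambda>f. x #> f) ` F'"
    have finF': "finite F'" and finD': "finite D'" using F D by (auto simp: F'_def D'_def finite_subset)
    obtain f\<^sub>0 where f0: "f\<^sub>0 \<in> F'" using ne by (auto simp: F'_def)
    then have f0G: "f\<^sub>0 \<in> carrier G" using F by (auto simp: F'_def)
    have cardT: "card T = card F'"
      unfolding T_def by (rule card_image) (use Z(2) x in \<open>auto simp: F'_def inj_on_def\<close>)
    have TY: "T \<subseteq> Y" by (auto simp: T_def F'_def)
    have "T \<noteq> {}" using f0 by (auto simp: T_def)
    then have "card (Y - T) < card Y" using TY finY by (intro psubset_card_mono) auto
    have "Y - T \<subseteq> rcosets H" using Y by blast
    from less.hyps[OF \<open>card (Y - T) < card Y\<close> this] obtain E' where E': "finite E'" "E' \<subseteq> (rcosets H) \<times> carrier G"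
      and cardE': "card E' \<le> card (Y - T) + card S * (2 * \<delta> * card (Y - T) + 2 * card (rcosets H - Z))"
      and invE': "\<And>P w s. arrow_invariant H E' P \<Longrightarrow> w \<in> carrier G \<Longrightarrow> s \<in> S \<Longrightarrow>
        H #> w \<in> Y - T \<Longrightarrow> H #> (w \<otimes> s) \<in> Y - T \<Longrightarrow> w \<in> P \<longleftrightarrow> w \<otimes> s \<in> P"
      by (elim exE conjE) (rule that, assumption, blast+)
    define star where "star = (\<lambda>f. (x #> f\<^sub>0, inv f\<^sub>0 \<otimes> f)) ` F'"
    define rim where "rim = (\<lambda>(f, s). (x #> f, s)) ` (D' \<times> S)"
    define E where "E = E' \<union> star \<union> rim"
    have "finite E" using E'(1) finF' finD' S(1) by (auto simp: E_def star_def rim_def)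
    moreover have "E \<subseteq> (rcosets H) \<times> carrier G"
      using E'(2) f0G F(2) S(2) D(1) rcosets_r_coset_closed[OF H xX]
      by (auto simp: E_def star_def rim_def F'_def D'_def)
    moreover have "card E \<le> card Y + card S * (2 * \<delta> * card Y + 2 * card (rcosets H - Z))"
    proof -
      have "card E \<le> card E' + card star + card rim"
        unfolding E_def using card_Un_le[of "E' \<union> star" rim] card_Un_le[of E' star] by linarith
      moreover have "card star \<le> card T"
        unfolding cardT star_def by (rule card_image_le[OF finF'])
      moreover have "card rim \<le> card D' * card S"
        unfolding rim_def using card_image_le[of "D' \<times> S"] finD' S(1)
        by (simp add: card_cartesian_product)
      ultimately have "real (card E) \<le> card E' + card T + card D' * card S"
        using of_nat_mono[of "card E" "card E' + card T + card D' * card S"] by simp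
      moreover have "real (card D') * card S \<le> 2 * \<delta> * card T * card S"
        using small by (intro mult_right_mono) (simp_all add: cardT F'_def D'_def)
      moreover have "real (card Y) = card (Y - T) + card T"
        using card_Diff_subset[OF finite_subset[OF TY finY] TY] card_mono[OF finY TY] by simp
      ultimately show ?thesis using cardE' by (simp add: algebra_simps)
    qed
    moreover have "w \<in> P \<longleftrightarrow> w \<otimes> s \<in> P"
      if P: "arrow_invariant H E P" and ws: "w \<in> carrier G" "s \<in> S" "H #> w \<in> Y" "H #> (w \<otimes> s) \<in> Y"
      for P w s
    proof -
      have invP: "u \<in> P \<longleftrightarrow> u \<otimes> e \<in> P" if "u \<in> carrier G" "(H #> u, e) \<in> E" for u e
        using P that by (auto simp: arrow_invariant_def)
      \<comment> \<open>From a point over \<open>D\<close> the arrow itself is in the rim. From any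
        other point the arrow ends in the same tile, so it is the inverse of one star arrow followed
        by another.\<close>
      have leave: "u \<in> P \<longleftrightarrow> u \<otimes> t \<in> P"
        if u: "u \<in> carrier G" and t: "t \<in> S" and uT: "H #> u \<in> T" and utY: "H #> (u \<otimes> t) \<in> Y" for u t
      proof -
        obtain f where f: "f \<in> F'" "H #> u = x #> f" using uT by (auto simp: T_def)
        have fG: "f \<in> carrier G" "t \<in> carrier G" using f F S t by (auto simp: F'_def)
        show ?thesis
        proof (cases "f \<in> D")
          case True
          then have "(H #> u, t) \<in> E" using f t by (force simp: E_def rim_def D'_def F'_def)
          then show ?thesis using invP u by blast
        next
          case False
          then have "f \<otimes> t \<in> F" using f t by (auto simp: D_def F'_def)
          moreover have "H #> (u \<otimes> t) = x #> (f \<otimes> t)"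
            using f u fG Hs xG by (metis coset_mult_assoc)
          ultimately have ft: "f \<otimes> t \<in> F'" using utY by (simp add: F'_def)
          \<comment> \<open>The element over the centre of the star from which star arrows lead to
            both \<open>u\<close> and \<open>u \<otimes> t\<close>.\<close>
          define v where "v = u \<otimes> (inv f \<otimes> f\<^sub>0)"
          have v: "v \<in> carrier G" using u fG f0G by (simp add: v_def)
          have "H #> v = (x #> f) #> (inv f \<otimes> f\<^sub>0)"
            unfolding v_def f(2)[symmetric] using u fG f0G Hs by (simp add: coset_mult_assoc)
          also have "\<dots> = x #> f\<^sub>0"
            using fG f0G xG by (simp add: coset_mult_assoc m_assoc[symmetric])
          finally have Hv: "H #> v = x #> f\<^sub>0" .
          have vu: "v \<otimes> (inv f\<^sub>0 \<otimes> f) = u"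
            unfolding v_def using u fG f0G by (simp add: m_assoc inv_mult_cancel)
          have "v \<otimes> (inv f\<^sub>0 \<otimes> (f \<otimes> t)) = v \<otimes> (inv f\<^sub>0 \<otimes> f) \<otimes> t"
            using v fG f0G by (simp add: m_assoc)
          then have vut: "v \<otimes> (inv f\<^sub>0 \<otimes> (f \<otimes> t)) = u \<otimes> t" using vu by simp
          have "(H #> v, inv f\<^sub>0 \<otimes> f) \<in> E" "(H #> v, inv f\<^sub>0 \<otimes> (f \<otimes> t)) \<in> E"
            using Hv f ft by (auto simp: E_def star_def)
          then show ?thesis using invP[OF v] vu vut by metis
        qed
      qed
      have sG: "s \<in> carrier G" using ws S by blast
      consider "H #> w \<in> T" | "H #> (w \<otimes> s) \<in> T" | "H #> w \<in> Y - T" "H #> (w \<otimes> s) \<in> Y - T"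
        using ws by blast
      then show ?thesis
      proof cases
        case 1
        then show ?thesis using leave ws by blast
      next
        case 2
        have "(w \<otimes> s) \<otimes> inv s = w" using ws sG by (simp add: m_assoc)
        then show ?thesis using leave[of "w \<otimes> s" "inv s"] 2 ws sG S(3) by auto
      next
        case 3
        moreover have "arrow_invariant H E' P" using P by (auto simp: arrow_invariant_def E_def)
        ultimately show ?thesis using invE' ws by blast
      qed
    qed
    ultimately show ?thesis by blast
  qed
qed

text \<open>The cheap arrows for \<open>Y\<close> equal to all cosets generate the groupoid, since a
  set invariant under them that contains \<open>\<one>\<close> is closed under right multiplication
  by \<open>S\<close>. The leading term of their number cancels against the spanning tree.\<close>

theorem subgroup_rank_le_Folner:
  fixes \<delta> :: real
  assumes H: "subgroup H G" and fin: "finite (rcosets H)"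
    and S: "finite S" "symmetric_generating_set G S"
    and F: "finite F" "F \<subseteq> carrier G" "F \<noteq> {}" "card {f \<in> F. \<exists>s\<in>S. f \<otimes> s \<notin> F} \<le> \<delta> * card F"
  shows "real (min_generators (G\<lparr>carrier := H\<rparr>)) - 1 \<le> card S * (2 * \<delta> * card (rcosets H)
    + 2 * card {x \<in> rcosets H. \<not> inj_on (\<lambda>f. x #> f) F})"
proof -
  define Z where "Z = {x \<in> rcosets H. inj_on (\<lambda>f. x #> f) F}"
  have Z: "Z \<subseteq> rcosets H" "\<forall>x\<in>Z. inj_on (\<lambda>f. x #> f) F" by (auto simp: Z_def)
  have XZ: "rcosets H - Z = {x \<in> rcosets H. \<not> inj_on (\<lambda>f. x #> f) F}" by (auto simp: Z_def)
  have Hs: "H \<subseteq> carrier G" using subgroup.subset[OF H] .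
  have SG: "S \<subseteq> carrier G" and inv: "\<forall>s\<in>S. inv s \<in> S" and gen: "generate G S = carrier G"
    using S(2) by (auto simp: symmetric_generating_set_def)
  obtain E where E: "finite E" "E \<subseteq> (rcosets H) \<times> carrier G"
    and cardE: "card E \<le> card (rcosets H)
      + card S * (2 * \<delta> * card (rcosets H) + 2 * card (rcosets H - Z))"
    and invE: "\<And>P w s. arrow_invariant H E P \<Longrightarrow> w \<in> carrier G \<Longrightarrow> s \<in> S \<Longrightarrow>
        H #> w \<in> rcosets H \<Longrightarrow> H #> (w \<otimes> s) \<in> rcosets H \<Longrightarrow> w \<in> P \<longleftrightarrow> w \<otimes> s \<in> P"
    using ex_cheap_arrows[OF H fin S(1) SG inv F Z order_refl]
    by (elim exE conjE) (rule that, assumption, blast+)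
  have "\<exists>A\<subseteq>H. finite A \<and> generate G A = H \<and> card A + card (rcosets H) \<le> card E + 1"
  proof (rule subgroup_rank_le_arrows[OF H fin E])
    fix P assume P: "P \<subseteq> carrier G" "\<one> \<in> P"
      "\<And>w e. w \<in> carrier G \<Longrightarrow> (H #> w, e) \<in> E \<Longrightarrow> w \<in> P \<longleftrightarrow> w \<otimes> e \<in> P"
    have "arrow_invariant H E P" using P(3) by (auto simp: arrow_invariant_def)
    then have step: "w \<otimes> s \<in> P" if "w \<in> P" "s \<in> S" for w s
      using invE[of P w s] that P(1) SG Hs by (auto intro!: rcosetsI)
    have "\<forall>w\<in>P. w \<otimes> g \<in> P" if "g \<in> generate G S" for g
      using that
    proof (induction rule: generate.induct)
      case (eng g h)
      show ?case
      proof
        fix w assume w: "w \<in> P"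
        then have "(w \<otimes> g) \<otimes> h \<in> P" using eng.IH by blast
        moreover have "g \<in> carrier G" "h \<in> carrier G"
          using eng.hyps generate_in_carrier[OF SG] by auto
        ultimately show "w \<otimes> (g \<otimes> h) \<in> P" using w P(1) by (simp add: m_assoc subset_iff)
      qed
    qed (use step inv P(1) in auto)
    then have "\<one> \<otimes> g \<in> P" if "g \<in> carrier G" for g using P(2) gen that by blast
    then show "P = carrier G" using P(1) by auto
  qed
  then obtain A where A: "A \<subseteq> H" "finite A" "generate G A = H"
    "card A + card (rcosets H) \<le> card E + 1" by blast
  have "generate (G\<lparr>carrier := H\<rparr>) A = H" using generate_consistent[OF A(1) H] A(3) by simp
  then have "min_generators (G\<lparr>carrier := H\<rparr>) \<le> card A"
    unfolding min_generators_def using A by (intro Least_le) auto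
  then show ?thesis unfolding XZ[symmetric] using A(4) cardE by linarith
qed

end

section \<open>Farber sequences\<close>

context group
begin

text \<open>The length is exactly \<open>k\<close>, to match the relational powers of the adjacency
  in \<open>ball_verts\<close>.\<close>

primrec words :: "'a set \<Rightarrow> nat \<Rightarrow> 'a set" where
  "words S 0 = {\<one>}"
| "words S (Suc k) = words S k <#> S"

lemma words_carrier:
  assumes "S \<subseteq> carrier G" shows "words S k \<subseteq> carrier G"
  using assms by (induction k) (auto simp: set_mult_def subset_iff)

lemma words_add:
  assumes "S \<subseteq> carrier G" shows "words S (m + n) = words S m <#> words S n"
proof (induction n)
  case 0
  have "words S m <#> {\<one>} = words S m"
    using words_carrier[OF assms, of m] by (force simp: set_mult_def)
  then show ?case by simp
next
  case (Suc n)
  then show ?case by (simp add: set_mult_assoc words_carrier assms)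
qed

lemma carrier_eq_words:
  assumes "symmetric_generating_set G S"
  shows "carrier G = (\<Union>k. words S k)"
proof
  have S: "S \<subseteq> carrier G" "\<And>s. s \<in> S \<Longrightarrow> inv s \<in> S" and gen: "generate G S = carrier G"
    using assms by (auto simp: symmetric_generating_set_def)
  have S1: "S \<subseteq> words S 1" using S(1) by (force simp: set_mult_def)
  have "\<exists>k. g \<in> words S k" if "g \<in> generate G S" for g
    using that
  proof (induction rule: generate.induct)
    case one
    show ?case by (rule exI[of _ 0]) simp
  next
    case (eng g h)
    then obtain m n where "g \<in> words S m" "h \<in> words S n" by blast
    then have "g \<otimes> h \<in> words S (m + n)" by (auto simp: words_add[OF S(1)] set_mult_def)
    then show ?case by blast
  qed (use S S1 in blast)+
  then show "carrier G \<subseteq> (\<Union>k. words S k)" using gen by blast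
  show "(\<Union>k. words S k) \<subseteq> carrier G" using words_carrier[OF S(1)] by blast
qed

lemma words_in_schreier_ball:
  assumes H: "subgroup H G" and S: "S \<subseteq> carrier G" and v: "v \<in> rcosets H"
    and g: "g \<in> words S k" and k: "k \<le> r"
  shows "v #> g \<in> ball_verts (schreier_graph G H S) v r"
proof -
  have vG: "v \<subseteq> carrier G" by (rule rcosets_subset_carrier[OF H v])
  have "(v, v #> g) \<in> adjacency (schreier_graph G H S) ^^ k"
    using g
  proof (induction k arbitrary: g)
    case 0
    then show ?case using vG by simp
  next
    case (Suc k)
    then obtain h s where hs: "h \<in> words S k" "s \<in> S" "g = h \<otimes> s" by (auto simp: set_mult_def)
    have G: "h \<in> carrier G" "s \<in> carrier G" using hs S words_carrier[OF S] by auto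
    have "v #> g = (v #> h) #> s" using hs G vG by (simp add: coset_mult_assoc)
    then have "(v #> h, v #> g) \<in> adjacency (schreier_graph G H S)"
      using hs rcosets_r_coset_closed[OF H v G(1)] by (auto simp: adjacency_def schreier_graph_def)
    then show ?case using Suc.IH[OF hs(1)] by auto
  qed
  moreover have "v #> g \<in> rcosets H"
    using rcosets_r_coset_closed[OF H v] g words_carrier[OF S] by blast
  ultimately show ?thesis using k by (auto simp: ball_verts_def schreier_graph_def)
qed

text \<open>In the Cayley graph the edge labelled \<open>s\<close> from \<open>h\<close> can only
  end at \<open>h \<otimes> s\<close>. Following the letters of a word from the root therefore gives
  \<open>\<phi> (v #> g) = g\<close>, so \<open>\<phi>\<close> is a left inverse of the orbit
  map.\<close>

lemma inj_on_words_if_rooted_isomorphic: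
  assumes H: "subgroup H G" and S: "S \<subseteq> carrier G" and v: "v \<in> rcosets H"
    and iso: "rooted_isomorphic (graph_ball (schreier_graph G H S) v r) v
      (graph_ball (cayley_graph G S) \<one> r) \<one>"
  shows "inj_on (\<lambda>g. v #> g) (\<Union>k\<le>r. words S k)"
proof -
  let ?B = "graph_ball (schreier_graph G H S) v r"
  obtain \<phi> where \<phi>v: "\<phi> v = \<one>"
    and \<phi>: "\<And>u u' s. u \<in> verts ?B \<Longrightarrow> u' \<in> verts ?B \<Longrightarrow> (u, s, u') \<in> edges ?B \<Longrightarrow>
      (\<phi> u, s, \<phi> u') \<in> edges (graph_ball (cayley_graph G S) \<one> r)"
    using iso unfolding rooted_isomorphic_def by (elim exE conjE) (rule that, assumption, blast+)
  have vG: "v \<subseteq> carrier G" by (rule rcosets_subset_carrier[OF H v])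
  have "\<phi> (v #> g) = g" if "g \<in> words S k" "k \<le> r" for g k
    using that
  proof (induction k arbitrary: g)
    case 0
    then show ?case using vG \<phi>v by simp
  next
    case (Suc k)
    then obtain h s where hs: "h \<in> words S k" "s \<in> S" "g = h \<otimes> s" by (auto simp: set_mult_def)
    have G: "h \<in> carrier G" "s \<in> carrier G" using hs S words_carrier[OF S] by auto
    have eq: "v #> g = (v #> h) #> s" using hs G vG by (simp add: coset_mult_assoc)
    have V: "v #> h \<in> verts ?B" "v #> g \<in> verts ?B"
      using words_in_schreier_ball[OF H S v hs(1)] words_in_schreier_ball[OF H S v Suc.prems] Suc.prems(2)
      by (auto simp: graph_ball_def)
    have "(v #> h, s, v #> g) \<in> edges ?B"
      using V eq hs(2) rcosets_r_coset_closed[OF H v G(1)]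
      by (auto simp: graph_ball_def schreier_graph_def)
    from \<phi>[OF V this] have "\<phi> (v #> g) = \<phi> (v #> h) \<otimes> s"
      by (auto simp: graph_ball_def cayley_graph_def)
    then show ?case using Suc.IH[OF hs(1)] Suc.prems hs(3) by simp
  qed
  then show ?thesis by (intro inj_on_inverseI[where g = \<phi>]) auto
qed

lemma sofic_eventually_inj_on:
  fixes \<eta> :: real
  assumes \<Gamma>: "\<And>n. finite_index_subgroup (\<Gamma> n) G" and S: "symmetric_generating_set G S"
    and sofic: "sofic_approximation G S (\<lambda>n. schreier_graph G (\<Gamma> n) S)"
    and F: "finite F" "F \<subseteq> carrier G" and \<eta>: "\<eta> > 0"
  shows "\<forall>\<^sub>F n in sequentially. card {x \<in> rcosets \<Gamma> n. \<not> inj_on (\<lambda>f. x #> f) F}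
    \<le> \<eta> * card (rcosets \<Gamma> n)"
proof -
  have SG: "S \<subseteq> carrier G" using S by (simp add: symmetric_generating_set_def)
  have "\<forall>f\<in>F. \<exists>k. f \<in> words S k" using F(2) carrier_eq_words[OF S] by blast
  then obtain \<kappa> where \<kappa>: "\<And>f. f \<in> F \<Longrightarrow> f \<in> words S (\<kappa> f)" by metis
  \<comment> \<open>For empty \<open>F\<close> this maximum is unspecified, but then the inclusion
    \<open>Fr\<close> is vacuous.\<close>
  define r where "r = Max (\<kappa> ` F)"
  have Fr: "F \<subseteq> (\<Union>k\<le>r. words S k)"
    using \<kappa> F(1) by (fastforce simp: r_def)
  define good where "good n = {v \<in> verts (schreier_graph G (\<Gamma> n) S).
    rooted_isomorphic (graph_ball (schreier_graph G (\<Gamma> n) S) v r) v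
      (graph_ball (cayley_graph G S) \<one> r) \<one>}" for n
  have "(\<lambda>n. card (good n) / card (rcosets \<Gamma> n)) \<longlonglongrightarrow> 1"
    using sofic unfolding sofic_approximation_def good_def by (simp add: schreier_graph_def)
  then have "\<forall>\<^sub>F n in sequentially. 1 - \<eta> < card (good n) / card (rcosets \<Gamma> n)"
    using \<eta> by (intro order_tendstoD(1)[where y = 1]) auto
  then show ?thesis
  proof eventually_elim
    case (elim n)
    have H: "subgroup (\<Gamma> n) G" and fin: "finite (rcosets \<Gamma> n)"
      using \<Gamma>[of n] by (auto simp: finite_index_subgroup_def)
    have "rcosets \<Gamma> n \<noteq> {}" using subgroup.subgroup_in_rcosets[OF H is_group] by blast
    then have pos: "0 < real (card (rcosets \<Gamma> n))" using fin by (simp add: card_gt_0_iff)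
    have sub: "good n \<subseteq> rcosets \<Gamma> n" by (auto simp: good_def schreier_graph_def)
    have "{x \<in> rcosets \<Gamma> n. \<not> inj_on (\<lambda>f. x #> f) F} \<subseteq> rcosets \<Gamma> n - good n"
      using inj_on_words_if_rooted_isomorphic[OF H SG] inj_on_subset[OF _ Fr]
      by (auto simp: good_def)
    then have "card {x \<in> rcosets \<Gamma> n. \<not> inj_on (\<lambda>f. x #> f) F} \<le> card (rcosets \<Gamma> n - good n)"
      using fin by (intro card_mono) auto
    also have "\<dots> = card (rcosets \<Gamma> n) - card (good n)"
      using sub fin finite_subset by (intro card_Diff_subset) auto
    finally have "card {x \<in> rcosets \<Gamma> n. \<not> inj_on (\<lambda>f. x #> f) F}
        \<le> real (card (rcosets \<Gamma> n)) - card (good n)"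
      using card_mono[OF fin sub] by linarith
    moreover have "(1 - \<eta>) * card (rcosets \<Gamma> n) < card (good n)"
      using elim pos by (simp add: field_simps)
    ultimately show ?case by (simp add: algebra_simps)
  qed
qed

text \<open>The upper bound comes from a Folner set. The numerator may also be -1, so the lower
  bound needs the index to tend to infinity; this follows from injectivity on arbitrarily large
  finite sets and is where infiniteness of the group enters.\<close>

theorem amenable_farber_rank_gradient:
  assumes inf: "infinite (carrier G)" and am: "amenable G" and farber: "farber_sequence G \<Gamma>"
  shows "has_rank_gradient G \<Gamma> 0"
proof -
  obtain S where \<Gamma>: "\<And>n. finite_index_subgroup (\<Gamma> n) G"
    and S: "finite S" "symmetric_generating_set G S"
    and sofic: "sofic_approximation G S (\<lambda>n. schreier_graph G (\<Gamma> n) S)"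
    using farber by (auto simp: farber_sequence_def)
  have SG: "S \<subseteq> carrier G" using S(2) by (simp add: symmetric_generating_set_def)
  have sub: "subgroup (\<Gamma> n) G" and fin: "finite (rcosets \<Gamma> n)" for n
    using \<Gamma>[of n] by (auto simp: finite_index_subgroup_def)
  have pos: "0 < card (rcosets \<Gamma> n)" for n
    using subgroup.subgroup_in_rcosets[OF sub is_group] fin card_gt_0_iff by blast
  define d where "d n = real (min_generators (G\<lparr>carrier := \<Gamma> n\<rparr>))" for n
  have "\<forall>\<^sub>F n in sequentially. \<bar>(d n - 1) / card (rcosets \<Gamma> n)\<bar> < \<epsilon>" if \<epsilon>: "\<epsilon> > 0" for \<epsilon> :: real
  proof -
    \<comment> \<open>Boundary and non-injective tiles each contribute \<open>2 * \<delta>\<close>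
      per generator and coset; |S| + 1 in the denominator makes the total strictly less than
      \<open>\<epsilon>\<close>.\<close>
    define \<delta> where "\<delta> = \<epsilon> / (4 * (card S + 1))"
    have \<delta>: "\<delta> > 0" using \<epsilon> by (simp add: \<delta>_def)
    have \<delta>\<epsilon>: "card S * (4 * \<delta>) < \<epsilon>" using \<epsilon> by (simp add: \<delta>_def field_simps)
    obtain F where F: "finite F" "F \<noteq> {}" "F \<subseteq> carrier G"
      "card {f \<in> F. \<exists>s\<in>S. f \<otimes> s \<notin> F} \<le> \<delta> * card F"
      using amenable_imp_Folner[OF am S(1) SG \<delta>] by blast
    obtain N :: nat where N: "1 / \<epsilon> < N" using reals_Archimedean2 by blast
    obtain F' where F': "finite F'" "card F' = N" "F' \<subseteq> carrier G"
      using infinite_arbitrarily_large[OF inf] by blast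
    have "\<forall>\<^sub>F n in sequentially. card {x \<in> rcosets \<Gamma> n. \<not> inj_on (\<lambda>f. x #> f) F}
        \<le> \<delta> * card (rcosets \<Gamma> n)"
      by (rule sofic_eventually_inj_on[OF \<Gamma> S(2) sofic F(1,3) \<delta>])
    \<comment> \<open>Any proportion below 1 would do: a single coset \<open>x\<close> on which
      \<open>F'\<close> acts injectively produces \<open>N\<close> distinct cosets, so the index
      exceeds \<open>1 / \<epsilon>\<close>.\<close>
    moreover have "\<forall>\<^sub>F n in sequentially. card {x \<in> rcosets \<Gamma> n. \<not> inj_on (\<lambda>f. x #> f) F'}
        \<le> (1/2) * card (rcosets \<Gamma> n)"
      by (rule sofic_eventually_inj_on[OF \<Gamma> S(2) sofic F'(1,3)]) simp
    ultimately show ?thesis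
    proof eventually_elim
      case (elim n)
      let ?m = "card (rcosets \<Gamma> n)"
      let ?bad = "card {x \<in> rcosets \<Gamma> n. \<not> inj_on (\<lambda>f. x #> f) F}"
      have m: "0 < real ?m" using pos by simp
      have "{x \<in> rcosets \<Gamma> n. \<not> inj_on (\<lambda>f. x #> f) F'} \<noteq> rcosets \<Gamma> n"
      proof
        assume "{x \<in> rcosets \<Gamma> n. \<not> inj_on (\<lambda>f. x #> f) F'} = rcosets \<Gamma> n"
        then show False using elim(2) m by simp
      qed
      then obtain x where x: "x \<in> rcosets \<Gamma> n" "inj_on (\<lambda>f. x #> f) F'" by blast
      have "card F' \<le> ?m"
        by (rule card_inj_on_le[OF x(2) _ fin]) (use rcosets_r_coset_closed[OF sub x(1)] F'(3) in auto)
      then have "1 / \<epsilon> < ?m" using N F'(2) by linarith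
      then have lower: "1 < \<epsilon> * ?m" using \<epsilon> by (simp add: field_simps)
      have "d n - 1 \<le> card S * (2 * \<delta> * ?m + 2 * ?bad)"
        unfolding d_def by (rule subgroup_rank_le_Folner[OF sub fin S F(1,3,2,4)])
      also have "\<dots> \<le> card S * (4 * \<delta> * ?m)"
        using elim(1) by (intro mult_left_mono) auto
      also have "\<dots> < \<epsilon> * ?m"
        using mult_strict_right_mono[OF \<delta>\<epsilon> m] by (simp add: algebra_simps)
      finally have "d n - 1 < \<epsilon> * ?m" .
      moreover have "d n \<ge> 0" by (simp add: d_def)
      ultimately have "\<bar>d n - 1\<bar> < \<epsilon> * ?m" using lower by linarith
      then show ?case using m by (simp add: abs_divide field_simps)
    qed
  qed
  then have "(\<lambda>n. (d n - 1) / card (rcosets \<Gamma> n)) \<longlonglongrightarrow> 0"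
    by (intro tendstoI) (simp add: dist_real_def)
  then show ?thesis by (simp add: has_rank_gradient_def subgroup_index_def d_def)
qed

end

theorem corollary5:
  fixes G :: "('a, 'b) monoid_scheme" and \<Gamma> :: "nat \<Rightarrow> 'a set"
  assumes "group G"
    and "infinite (carrier G)"
    and "finitely_generated G"
    and "amenable G"
    and "farber_sequence G \<Gamma>"
  shows "has_rank_gradient G \<Gamma> 0"
  using group.amenable_farber_rank_gradient assms(1,2,4,5) .

end
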